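(* Let $R$ be an associative ring with unity. If $R$ is a McCoy ring, then $R$ is inner McCoy.
   Context: All rings are associative with unity. For a ring $R$, $R[x]$ denotes the polynomial ring in an indeterminate $x$ commuting with $R$. A ring $R$ is left McCoy if for every pair of nonzero $f(x), g(x) \in R[x]$ with $f(x)g(x) = 0$ there is a nonzero $s \in R$ with $s g(x) = 0$. It is right McCoy if for every pair of nonzero $f(x), g(x) \in R[x]$ with $f(x)g(x)=0$ there is a nonzero $t \in R$ with $f(x)t = 0$. It is McCoy if it is both left McCoy and right McCoy. A ring $R$ is inner McCoy if for every pair $f(x), g(x) \in R[x]\setminus\{0\}$ with $f(x)g(x)f(x) = 0$ there exists $r \in R\setminus\{0\}$ such that $f(x)\, r\, f(x) = 0$. *)

theory Defs
  imports "HOL-Algebra.UnivPoly"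
begin

text \<open>
  \<^term>\<open>UP R\<close> is the polynomial ring over an arbitrary, not necessarily commutative, ring:
  the indeterminate commutes with the coefficients. An element \<open>r\<close> of \<open>R\<close> occurring in a product
  with polynomials is the constant polynomial \<open>r\<close>.
\<close>

abbreviation const_poly :: "('a, 'm) ring_scheme \<Rightarrow> 'a \<Rightarrow> nat \<Rightarrow> 'a"
  where "const_poly R r \<equiv> monom (UP R) r 0"

definition left_McCoy :: "('a, 'm) ring_scheme \<Rightarrow> bool"
  where "left_McCoy R \<longleftrightarrow>
    (\<forall>f \<in> carrier (UP R) - {\<zero>\<^bsub>UP R\<^esub>}. \<forall>g \<in> carrier (UP R) - {\<zero>\<^bsub>UP R\<^esub>}.
      f \<otimes>\<^bsub>UP R\<^esub> g = \<zero>\<^bsub>UP R\<^esub> \<longrightarrow>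
      (\<exists>s \<in> carrier R - {\<zero>\<^bsub>R\<^esub>}. const_poly R s \<otimes>\<^bsub>UP R\<^esub> g = \<zero>\<^bsub>UP R\<^esub>))"

definition right_McCoy :: "('a, 'm) ring_scheme \<Rightarrow> bool"
  where "right_McCoy R \<longleftrightarrow>
    (\<forall>f \<in> carrier (UP R) - {\<zero>\<^bsub>UP R\<^esub>}. \<forall>g \<in> carrier (UP R) - {\<zero>\<^bsub>UP R\<^esub>}.
      f \<otimes>\<^bsub>UP R\<^esub> g = \<zero>\<^bsub>UP R\<^esub> \<longrightarrow>
      (\<exists>t \<in> carrier R - {\<zero>\<^bsub>R\<^esub>}. f \<otimes>\<^bsub>UP R\<^esub> const_poly R t = \<zero>\<^bsub>UP R\<^esub>))"

definition McCoy :: "('a, 'm) ring_scheme \<Rightarrow> bool"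
  where "McCoy R \<longleftrightarrow> left_McCoy R \<and> right_McCoy R"

definition inner_McCoy :: "('a, 'm) ring_scheme \<Rightarrow> bool"
  where "inner_McCoy R \<longleftrightarrow>
    (\<forall>f \<in> carrier (UP R) - {\<zero>\<^bsub>UP R\<^esub>}. \<forall>g \<in> carrier (UP R) - {\<zero>\<^bsub>UP R\<^esub>}.
      f \<otimes>\<^bsub>UP R\<^esub> g \<otimes>\<^bsub>UP R\<^esub> f = \<zero>\<^bsub>UP R\<^esub> \<longrightarrow>
      (\<exists>r \<in> carrier R - {\<zero>\<^bsub>R\<^esub>}. f \<otimes>\<^bsub>UP R\<^esub> const_poly R r \<otimes>\<^bsub>UP R\<^esub> f = \<zero>\<^bsub>UP R\<^esub>))"

end

theory Submission
  imports Defs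
begin

text \<open>
  Any nonzero constant annihilating \<open>f\<close> on either side witnesses the inner property, because
  \<open>f s f\<close> vanishes as soon as \<open>s f = 0\<close> or \<open>f s = 0\<close>. If \<open>f g f = 0\<close>, then either \<open>f g\<close> is a
  nonzero left annihilator of \<open>f\<close>, and the left McCoy property replaces it by a constant, or
  \<open>f g = 0\<close>, and the right McCoy property replaces the right annihilator \<open>g\<close> by a constant.
\<close>

theorem theorem2p2:
  fixes R :: "('a, 'm) ring_scheme"
  assumes "ring R" and "McCoy R"
  shows "inner_McCoy R"
  unfolding inner_McCoy_def
proof (intro ballI impI)
  interpret UP_ring R "UP R"
    using \<open>ring R\<close> by (simp add: UP_ring_def)
  fix f g
  assume f: "f \<in> carrier (UP R) - {\<zero>\<^bsub>UP R\<^esub>}" and g: "g \<in> carrier (UP R) - {\<zero>\<^bsub>UP R\<^esub>}"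
    and fgf: "f \<otimes>\<^bsub>UP R\<^esub> g \<otimes>\<^bsub>UP R\<^esub> f = \<zero>\<^bsub>UP R\<^esub>"
  show "\<exists>r \<in> carrier R - {\<zero>\<^bsub>R\<^esub>}. f \<otimes>\<^bsub>UP R\<^esub> const_poly R r \<otimes>\<^bsub>UP R\<^esub> f = \<zero>\<^bsub>UP R\<^esub>"
  proof (cases "f \<otimes>\<^bsub>UP R\<^esub> g = \<zero>\<^bsub>UP R\<^esub>")
    case True
    then obtain t where "t \<in> carrier R - {\<zero>\<^bsub>R\<^esub>}" "f \<otimes>\<^bsub>UP R\<^esub> const_poly R t = \<zero>\<^bsub>UP R\<^esub>"
      using \<open>McCoy R\<close> f g unfolding McCoy_def right_McCoy_def by blast
    then show ?thesis
      using f by (intro bexI[of _ t]) simp_all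
  next
    case False
    then have "f \<otimes>\<^bsub>UP R\<^esub> g \<in> carrier (UP R) - {\<zero>\<^bsub>UP R\<^esub>}"
      using f g by simp
    then obtain s where "s \<in> carrier R - {\<zero>\<^bsub>R\<^esub>}" "const_poly R s \<otimes>\<^bsub>UP R\<^esub> f = \<zero>\<^bsub>UP R\<^esub>"
      using \<open>McCoy R\<close> f fgf unfolding McCoy_def left_McCoy_def by blast
    then show ?thesis
      using f by (intro bexI[of _ s]) (simp_all add: P.m_assoc)
  qed
qed

end
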